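(* Let $A(z)$ and $B(z)$ be polynomials in $z$ with complex coefficients, and let $(H_m(z))_{m\ge 0}$ be the sequence of polynomials defined by the generating function $$\sum_{m=0}^{\infty}H_{m}(z)t^{m}=\frac{1}{1+B(z)t+A(z)t^{3}}.$$ Let $\mathcal{C}_3$ be the set of all $z\in\mathbb{C}$ with $A(z)\neq 0$ such that $$\Im\frac{B^{3}(z)}{A(z)}=0\qquad\text{and}\qquad 0\le-\Re\frac{B^{3}(z)}{A(z)}\le \frac{3^3}{2^2}.$$ Then for every $m$, each root $z$ of $H_m$ with $A(z)\ne 0$ lies in $\mathcal{C}_3$. Moreover, these roots are dense in $\mathcal{C}_3$ as $m\to\infty$: for every $p\in\mathcal{C}_3$ and every open neighborhood $U$ of $p$ in $\mathbb{C}$, for all sufficiently large $m$ the polynomial $H_m$ has a root $z\in U$ with $A(z)\neq 0$.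
   Context: The generating function identity is one of formal power series in $t$ with coefficients in $\mathbb{C}[z]$. $\Re$ and $\Im$ denote real and imaginary parts. $B^3(z)$ means $(B(z))^3$.
   Formalization: The density claim is stated under the added assumption that B^3/A is not constant on the set where A(z) ≠ 0; without it the claim fails, e.g. for A = 1, B = 0, where C_3 is all of the complex plane but H_{3k} = (-1)^k has no root. *)

theory Defs
  imports "HOL-Analysis.Analysis" "HOL-Computational_Algebra.Computational_Algebra"
begin

definition curve3 :: "complex poly \<Rightarrow> complex poly \<Rightarrow> complex set" where
  "curve3 A B = {z. poly A z \<noteq> 0 \<and>
     Im (poly B z ^ 3 / poly A z) = 0 \<and>
     0 \<le> - Re (poly B z ^ 3 / poly A z) \<and>
     - Re (poly B z ^ 3 / poly A z) \<le> 3 ^ 3 / 2 ^ 2}"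

(* The polynomials H m are the coefficients of 1 / (1 + B t + A t^3) in the ring of formal
   power series over complex polynomials.  The type class inverse is not available for
   polynomial coefficients, so the quotient is expressed by the equation determining it:
   the denominator has constant coefficient 1 and is a unit, hence H exists and is unique. *)
definition has_genfun3 ::
  "complex poly \<Rightarrow> complex poly \<Rightarrow> (nat \<Rightarrow> complex poly) \<Rightarrow> bool" where
  "has_genfun3 A B H \<longleftrightarrow>
     Abs_fps H * (1 + fps_const B * fps_X + fps_const A * fps_X ^ 3) = 1"

end

theory Submission
  imports Defs "HOL-Complex_Analysis.Conformal_Mappings"
begin

text \<open>
  Fix \<open>z\<close> and write \<open>b = B(z)\<close>, \<open>a = A(z) \<noteq> 0\<close>.  Assigning weight \<open>1\<close> to \<open>b\<close> and weight \<open>3\<close> to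
  \<open>a\<close> makes \<open>H\<^sub>m\<close> homogeneous of weight \<open>m\<close>, so up to sign \<open>H\<^sub>m(z)\<close> is \<open>b\<close> to the power
  \<open>m mod 3\<close>, times \<open>a\<close> to the power \<open>m div 3\<close>, times \<open>P\<^sub>m(w)\<close> for a polynomial \<open>P\<^sub>m\<close> in the single
  quantity \<open>w = b\<^sup>3 / a\<close> (\<open>core_poly\<close>, \<open>recurrence_eq_core_poly\<close>).  As \<open>z\<close> lies on the curve exactly
  when \<open>w\<close> is in the real interval \<open>[-27/4, 0]\<close>, everything is a question about the roots of
  \<open>P\<^sub>m\<close>, which has degree at most \<open>q = m div 3\<close>.

  For \<open>w\<close> inside the interval, \<open>a\<close> and \<open>b\<close> can be chosen real such that the characteristic
  polynomial \<open>x\<^sup>3 + b x\<^sup>2 + a\<close> of the recurrence has two roots \<open>e\<^sup>i\<^sup>\<theta>, e\<^sup>-\<^sup>i\<^sup>\<theta>\<close> on the unit circle,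
  where \<open>0 < \<theta> < \<pi>/3\<close>.  The third root \<open>\<zeta> = -1 / (2 cos \<theta>)\<close> then has modulus below \<open>1\<close>.  In the
  resulting closed form (\<open>recurrence_closed_form\<close>) the term \<open>2 sin ((m + 1) \<theta>)\<close> outweighs the two
  others as soon as the sine is \<open>1\<close> or \<open>-1\<close>, that is, for \<open>\<theta> = (k + 1/2) \<pi> / (m + 1)\<close>.  Hence \<open>P\<^sub>m\<close>
  alternates in sign along these nodes (\<open>sign_core_poly_at_node\<close>).

  The first \<open>q\<close> nodes lie below \<open>\<pi>/3\<close>.  Together with \<open>w = 0\<close>, where \<open>P\<^sub>m\<close> is positive, they give
  \<open>q\<close> distinct roots in the interval, which is as many as the degree permits; so there are no others
  in the complex plane (\<open>core_poly_root_in_interval\<close>).  The nodes have spacing \<open>\<pi> / (m + 1)\<close>, hence the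
  roots of \<open>P\<^sub>m\<close> become dense in the interval (\<open>core_poly_roots_dense\<close>).  The open mapping theorem for
  the nonconstant function \<open>B\<^sup>3 / A\<close> transports this density to the curve.
\<close>

section \<open>Reduction to a polynomial in one variable\<close>

lemma induct_step3 [case_names 0 1 2 step]:
  assumes "P 0" "P 1" "P 2" "\<And>n. P n \<Longrightarrow> P (n + 2) \<Longrightarrow> P (n + 3)"
  shows "P (n :: nat)"
proof (induction n rule: less_induct)
  case (less n)
  consider "n = 0" | "n = 1" | "n = 2" | k where "n = k + 3"
    using that by (metis add.commute le_add_diff_inverse less_2_cases linorder_not_less
        less_Suc_eq numeral_3_eq_3 Suc_1 One_nat_def)
  then show ?case
    using assms less by cases auto
qed

text \<open>The coefficient of \<open>w\<close> to the power \<open>m div 3 - k\<close> in the \<open>m\<close>-th polynomial is the binomial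
coefficient \<open>m - 2 k\<close> over \<open>k\<close>.  The recursion mirrors \<open>H\<^sub>m = - b H\<^sub>m\<^sub>-\<^sub>1 - a H\<^sub>m\<^sub>-\<^sub>3\<close>: when \<open>m\<close> is a
multiple of \<open>3\<close>, the factors \<open>b\<close> and \<open>b\<^sup>2\<close> meet in the first term and form \<open>b\<^sup>3 = a w\<close>.  The definition
is generic in the ring so that the real and the complex polynomials are instances of the same one.\<close>

fun core_poly :: "nat \<Rightarrow> 'a :: comm_ring_1 poly" where
  "core_poly 0 = 1"
| "core_poly (Suc 0) = 1"
| "core_poly (Suc (Suc 0)) = 1"
| "core_poly (Suc (Suc (Suc n))) =
     (if 3 dvd n then pCons 0 (core_poly (Suc (Suc n))) else core_poly (Suc (Suc n)))
       + core_poly n"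

lemma core_poly_012: "core_poly 0 = 1" "core_poly 1 = 1" "core_poly 2 = 1"
  by (simp_all add: numeral_2_eq_2)

lemma core_poly_add3:
  "core_poly (n + 3) =
     (if 3 dvd n then pCons 0 (core_poly (n + 2)) else core_poly (n + 2)) + core_poly n"
  by (simp add: numeral_3_eq_3)

text \<open>Stated for an arbitrary field: the complex instance factors the values \<open>H\<^sub>m(z)\<close>, the real one
connects \<open>core_poly\<close> with the trigonometric closed form.\<close>

lemma recurrence_eq_core_poly:
  fixes h :: "nat \<Rightarrow> 'a :: field"
  assumes a: "a \<noteq> 0"
    and init: "h 0 = 1" "h 1 = - b" "h 2 = b\<^sup>2"
    and rec: "\<And>n. h (n + 3) = - b * h (n + 2) - a * h n"
  shows "h n = (-1) ^ n * b ^ (n mod 3) * a ^ (n div 3) * poly (core_poly n) (b ^ 3 / a)"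
proof (induction n rule: induct_step3)
  case (step n)
  have div3: "(n + 3) div 3 = Suc (n div 3)" "(n + 3) mod 3 = n mod 3"
    by simp_all
  have sgn: "(-1) ^ (n + 2) = ((-1) ^ n :: 'a)" "(-1) ^ (n + 3) = (- ((-1) ^ n) :: 'a)"
    by (simp_all add: power_add)
  show ?case
  proof (cases "3 dvd n")
    case True
    then have d: "(n + 2) div 3 = n div 3" "(n + 2) mod 3 = 2" "n mod 3 = 0"
      by presburger+
    show ?thesis
      unfolding rec step.IH div3 d sgn core_poly_add3 using True a
      by (simp add: field_simps power2_eq_square power3_eq_cube)
  next
    case False
    then have d: "(n + 2) div 3 = Suc (n div 3)"
      by presburger
    \<comment> \<open>\<open>n mod 3\<close> is \<open>1\<close> or \<open>2\<close> here, so the index \<open>n + 2\<close> has one factor \<open>b\<close> less.\<close>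
    have r: "b ^ (n mod 3) = b * b ^ ((n + 2) mod 3)"
    proof -
      have "n mod 3 = Suc ((n + 2) mod 3)" using False by presburger
      then show ?thesis by simp
    qed
    show ?thesis
      unfolding rec step.IH div3 d sgn core_poly_add3 r using False a
      by (simp add: algebra_simps)
  qed
qed (use init in \<open>simp_all add: core_poly_012\<close>)

lemma degree_core_poly: "degree (core_poly n) \<le> n div 3"
proof (induction n rule: induct_step3)
  case (step n)
  have "degree (if 3 dvd n then pCons 0 (core_poly (n + 2)) else core_poly (n + 2) :: 'a poly)
      \<le> Suc (n div 3)"
  proof (cases "3 dvd n")
    case True
    then have "(n + 2) div 3 = n div 3" by presburger
    with True step.IH(2) show ?thesis
      using degree_pCons_le[of "0 :: 'a" "core_poly (n + 2)"] by simp
  next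
    case False
    then have "(n + 2) div 3 = Suc (n div 3)" by presburger
    with False step.IH(2) show ?thesis by simp
  qed
  with step.IH(1) show ?case
    unfolding core_poly_add3 by (intro degree_add_le) simp_all
qed (simp_all add: core_poly_012)

lemma poly_core_poly_0_pos: "poly (core_poly n) 0 > (0 :: real)"
proof (induction n rule: induct_step3)
  case (step n)
  then show ?case by (auto simp: core_poly_add3 add_pos_pos)
qed (simp_all add: core_poly_012)

lemma poly_core_poly_of_real:
  "poly (core_poly n) (complex_of_real x) = complex_of_real (poly (core_poly n) x)"
  by (induction n rule: induct_step3) (simp_all add: core_poly_012 core_poly_add3)

section \<open>The trigonometric parametrisation of the interval\<close>

text \<open>The value of \<open>b\<^sup>3 / a\<close> for which \<open>x\<^sup>3 + b x\<^sup>2 + a\<close> has the roots \<open>e\<^sup>i\<^sup>\<theta>\<close> and \<open>e\<^sup>-\<^sup>i\<^sup>\<theta>\<close>.  As the linear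
coefficient is zero, the third root must be \<open>-1 / (2 cos \<theta>)\<close>, which gives \<open>a = 1 / (2 cos \<theta>)\<close> and
\<open>b = (1 - 4 cos\<^sup>2 \<theta>) / (2 cos \<theta>)\<close>.\<close>

definition angle_map :: "real \<Rightarrow> real" where
  "angle_map \<theta> = (1 - 4 * (cos \<theta>)\<^sup>2) ^ 3 / (4 * (cos \<theta>)\<^sup>2)"

lemma cos_gt_half:
  assumes "0 \<le> \<theta>" "\<theta> < pi / 3"
  shows "cos \<theta> > 1 / 2"
  using cos_monotone_0_pi[of \<theta> "pi / 3"] assms by (simp add: cos_60)

text \<open>In \<open>s = 4 cos\<^sup>2 \<theta>\<close>, which decreases from \<open>4\<close> to \<open>1\<close>, the map is \<open>- (s - 1)\<^sup>2 (1 - 1/s)\<close>, and both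
factors grow with \<open>s\<close>.  Hence \<open>[0, \<pi>/3]\<close> is mapped increasingly onto \<open>[-27/4, 0]\<close>.\<close>

lemma angle_map_less:
  assumes "0 \<le> \<theta>" "\<theta> < \<phi>" "\<phi> \<le> pi / 3"
  shows "angle_map \<theta> < angle_map \<phi>"
proof -
  define s t where "s = 4 * (cos \<phi>)\<^sup>2" and "t = 4 * (cos \<theta>)\<^sup>2"
  have c: "cos \<phi> < cos \<theta>" "1 / 2 \<le> cos \<phi>"
    using cos_monotone_0_pi[of \<theta> \<phi>] cos_monotone_0_pi_le[of \<phi> "pi / 3"] assms
    by (simp_all add: cos_60)
  have "(1 / 2)\<^sup>2 \<le> (cos \<phi>)\<^sup>2" "(cos \<phi>)\<^sup>2 < (cos \<theta>)\<^sup>2"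
    using c by (intro power_mono power_strict_mono; simp)+
  then have s: "1 \<le> s" "s < t"
    by (simp_all add: s_def t_def power2_eq_square)
  have "(s - 1) ^ 2 * (1 - 1 / s) \<le> (t - 1) ^ 2 * (1 - 1 / s)"
    using s by (intro mult_right_mono power_mono) auto
  also have "\<dots> < (t - 1) ^ 2 * (1 - 1 / t)"
    using s by (intro mult_strict_left_mono) (auto simp: field_simps)
  finally have "(s - 1) ^ 3 / s < (t - 1) ^ 3 / t"
    using s by (simp add: field_simps power2_eq_square power3_eq_cube)
  moreover have "(1 - x) ^ 3 / x = - ((x - 1) ^ 3 / x)" for x :: real
    by (metis minus_diff_eq minus_divide_left odd_numeral power_minus_odd)
  ultimately show ?thesis
    by (simp add: angle_map_def flip: s_def t_def)
qed

lemma angle_map_ends: "angle_map 0 = - 27 / 4" "angle_map (pi / 3) = 0"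
  by (simp_all add: angle_map_def cos_60 power2_eq_square)

lemma continuous_on_angle_map: "continuous_on {0..pi / 3} angle_map"
proof -
  have "cos \<theta> \<noteq> 0" if "\<theta> \<in> {0..pi / 3}" for \<theta>
    using cos_gt_zero[of \<theta>] that by (cases "\<theta> = 0") auto
  then show ?thesis
    unfolding angle_map_def by (intro continuous_intros) auto
qed

text \<open>This is the partial fraction decomposition of \<open>1 / ((1 - 2 t cos \<theta> + t\<^sup>2) (1 - \<zeta> t))\<close>, with denominators
cleared.  Both sides satisfy the same recurrence, so it suffices to compare three initial values.\<close>

lemma recurrence_closed_form:
  fixes h :: "nat \<Rightarrow> real"
  assumes \<zeta>: "2 * cos \<theta> * \<zeta> = - 1"
    and ab: "b = - (2 * cos \<theta> + \<zeta>)" "a = - \<zeta>"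
    and init: "h 0 = 1" "h 1 = - b" "h 2 = b\<^sup>2"
    and rec: "\<And>n. h (n + 3) = - b * h (n + 2) - a * h n"
  shows "(2 + \<zeta>\<^sup>2) * sin \<theta> * h n
    = 2 * sin (real (n + 1) * \<theta>) + \<zeta> * sin (real n * \<theta>) + \<zeta> ^ (n + 2) * sin \<theta>"
proof -
  define s where "s n = sin (real n * \<theta>)" for n
  define c where "c = cos \<theta>"
  have s_rec: "s (n + 2) = 2 * c * s (n + 1) - s n" for n
  proof -
    have "s (n + 2) + s n = 2 * sin (real (n + 1) * \<theta>) * cos \<theta>"
      using sin_plus_sin[of "real (n + 2) * \<theta>" "real n * \<theta>"]
      by (simp add: s_def algebra_simps add_divide_distrib)
    then have "s (n + 2) + s n = 2 * s (n + 1) * c" by (simp only: s_def c_def)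
    then show ?thesis by (simp add: algebra_simps)
  qed
  have s0: "s 0 = 0" "s 1 = sin \<theta>" by (simp_all add: s_def)
  have s23: "s 2 = 2 * c * s 1" "s 3 = 2 * c * s 2 - s 1"
    using s_rec[of 0] s_rec[of 1] s0 by (simp_all add: numeral_2_eq_2 numeral_3_eq_3)
  have char: "2 * c * \<zeta> + 1 = 0" using \<zeta> by (simp add: c_def)
  have b: "- b = 2 * c + \<zeta>" by (simp add: ab c_def)
  have "(2 + \<zeta>\<^sup>2) * s 1 * h n = 2 * s (n + 1) + \<zeta> * s n + \<zeta> ^ (n + 2) * s 1"
  proof (induction n rule: induct_step3)
    case 0
    then show ?case using init s0 by (simp add: algebra_simps power2_eq_square)
  next
    case 1
    \<comment> \<open>Here and below, the difference of the two sides is an explicit multiple of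
      \<open>2 c \<zeta> + 1\<close>, the vanishing linear coefficient of the characteristic polynomial.\<close>
    have "(2 + \<zeta>\<^sup>2) * s 1 * (2 * c + \<zeta>) - (2 * (2 * c * s 1) + \<zeta> * s 1 + \<zeta> ^ 3 * s 1)
        = (2 * c * \<zeta> + 1) * (\<zeta> * s 1)"
      by (simp add: algebra_simps power2_eq_square power3_eq_cube)
    then have "(2 + \<zeta>\<^sup>2) * s 1 * (2 * c + \<zeta>) = 2 * s 2 + \<zeta> * s 1 + \<zeta> ^ 3 * s 1"
      unfolding char s23 by simp
    then show ?case unfolding init b by (simp add: numeral_eq_Suc)
  next
    case 2
    have "(2 + \<zeta>\<^sup>2) * s 1 * (2 * c + \<zeta>)\<^sup>2
          - (2 * (2 * c * (2 * c * s 1) - s 1) + \<zeta> * (2 * c * s 1) + \<zeta> ^ 4 * s 1)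
        = (2 * c * \<zeta> + 1) * ((2 + \<zeta> * (2 * c + 2 * \<zeta>)) * s 1)"
      by (simp add: algebra_simps power2_eq_square power4_eq_xxxx)
    then have "(2 + \<zeta>\<^sup>2) * s 1 * (2 * c + \<zeta>)\<^sup>2 = 2 * s 3 + \<zeta> * s 2 + \<zeta> ^ 4 * s 1"
      unfolding char s23 by simp
    moreover have "b\<^sup>2 = (2 * c + \<zeta>)\<^sup>2" unfolding b[symmetric] by simp
    ultimately show ?case unfolding init by simp
  next
    case (step n)
    have s': "s (n + 2) = 2 * c * s (n + 1) - s n"
      "s (n + 3) = 2 * c * s (n + 2) - s (n + 1)"
      "s (n + 4) = 2 * c * s (n + 3) - s (n + 2)"
      using s_rec[of n] s_rec[of "n + 1"] s_rec[of "n + 2"]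
      by (simp_all add: numeral_eq_Suc)
    have "(2 + \<zeta>\<^sup>2) * s 1 * h (n + 3) = (2 * c + \<zeta>) * ((2 + \<zeta>\<^sup>2) * s 1 * h (n + 2))
        + \<zeta> * ((2 + \<zeta>\<^sup>2) * s 1 * h n)"
      unfolding rec b by (simp add: ab algebra_simps)
    also have "\<dots> = (2 * c + \<zeta>) * (2 * s (n + 3) + \<zeta> * s (n + 2) + \<zeta> ^ n * \<zeta> ^ 4 * s 1)
        + \<zeta> * (2 * s (n + 1) + \<zeta> * s n + \<zeta> ^ n * \<zeta> ^ 2 * s 1)"
      unfolding step.IH by (simp add: numeral_eq_Suc power_add mult_ac)
    also have "\<dots> = 2 * s (n + 4) + \<zeta> * s (n + 3) + \<zeta> ^ n * \<zeta> ^ 5 * s 1"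
    proof -
      have "(2 * c + \<zeta>) * (2 * s3 + \<zeta> * s2 + p * \<zeta> ^ 4 * t)
            + \<zeta> * (2 * s1 + \<zeta> * s0 + p * \<zeta> ^ 2 * t)
            - (2 * s4 + \<zeta> * s3 + p * \<zeta> ^ 5 * t)
          = (2 * c * \<zeta> + 1) * (2 * s2 + \<zeta> * s1 + p * \<zeta> ^ 3 * t)"
        if "s2 = 2 * c * s1 - s0" "s3 = 2 * c * s2 - s1" "s4 = 2 * c * s3 - s2"
        for s0 s1 s2 s3 s4 p t :: real
        unfolding that by (simp add: algebra_simps eval_nat_numeral)
      from this[OF s', of "\<zeta> ^ n" "s 1"] show ?thesis
        unfolding char by simp
    qed
    finally show ?case by (simp add: numeral_eq_Suc mult_ac)
  qed
  then show ?thesis by (simp add: s_def)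
qed

section \<open>Sign changes\<close>

text \<open>The solutions \<open>\<theta>\<close> of \<open>sin ((m + 1) \<theta>) = (-1)\<^sup>k\<close>, where the oscillating term of the closed form
is extremal.\<close>

definition node :: "nat \<Rightarrow> nat \<Rightarrow> real" where
  "node m k = (real k + 1 / 2) * pi / real (m + 1)"

text \<open>The coefficients of \<open>1 / (1 + b t + a t\<^sup>3)\<close> for given scalars \<open>a\<close> and \<open>b\<close>.\<close>

fun trinomial_coeff :: "'a :: comm_ring_1 \<Rightarrow> 'a \<Rightarrow> nat \<Rightarrow> 'a" where
  "trinomial_coeff a b 0 = 1"
| "trinomial_coeff a b (Suc 0) = - b"
| "trinomial_coeff a b (Suc (Suc 0)) = b\<^sup>2"
| "trinomial_coeff a b (Suc (Suc (Suc n))) =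
     - b * trinomial_coeff a b (Suc (Suc n)) - a * trinomial_coeff a b n"

text \<open>At the \<open>k\<close>-th node the leading term of the closed form is \<open>2 (-1)\<^sup>k\<close>, while the other two terms have
modulus below \<open>1\<close> and at most \<open>1\<close> because \<open>\<bar>\<zeta>\<bar> < 1\<close>.  So \<open>h m\<close> has the sign \<open>(-1)\<^sup>k\<close>.  Passing to
\<open>core_poly\<close> divides by powers of \<open>a > 0\<close> and \<open>b < 0\<close>, which leaves the sign of \<open>(-1)\<close> to the power
\<open>m div 3\<close>.\<close>

lemma sign_core_poly_at_node:
  assumes "node m k < pi / 3"
  shows "(-1) ^ (m div 3 + k) * poly (core_poly m) (angle_map (node m k)) > 0"
proof -
  define \<theta> where "\<theta> = node m k"
  define \<zeta> where "\<zeta> = - 1 / (2 * cos \<theta>)"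
  define a b where "a = - \<zeta>" and "b = - (2 * cos \<theta> + \<zeta>)"
  define h where "h = trinomial_coeff a b"
  have \<theta>: "0 < \<theta>" "\<theta> < pi / 3"
    using assms by (simp_all add: \<theta>_def node_def)
  have c: "1 / 2 < cos \<theta>" using cos_gt_half \<theta> by simp
  have sin: "0 < sin \<theta>" "sin \<theta> \<le> 1" using \<theta> by (auto intro!: sin_gt_zero)
  have \<zeta>: "2 * cos \<theta> * \<zeta> = - 1" "\<bar>\<zeta>\<bar> < 1" using c by (auto simp: \<zeta>_def field_simps)
  have ab: "a > 0" "b < 0" "b ^ 3 / a = angle_map \<theta>"
  proof -
    show "a > 0" using c by (simp add: a_def \<zeta>_def)
    have b: "b = (1 - 4 * (cos \<theta>)\<^sup>2) / (2 * cos \<theta>)"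
      using c by (simp add: b_def \<zeta>_def field_simps power2_eq_square)
    have "(1 / 2)\<^sup>2 < (cos \<theta>)\<^sup>2" using c by (intro power_strict_mono) auto
    then show "b < 0" using c unfolding b
      by (intro divide_neg_pos) (auto simp: power2_eq_square)
    show "b ^ 3 / a = angle_map \<theta>"
    proof -
      have cancel: "(x / y) ^ 3 / (1 / y) = x ^ 3 / y\<^sup>2" for x y :: real
        by (cases "y = 0") (simp_all add: power_divide power2_eq_square power3_eq_cube)
      have a: "a = 1 / (2 * cos \<theta>)"
        by (simp add: a_def \<zeta>_def)
      show ?thesis
        unfolding a b cancel by (simp add: angle_map_def power_mult_distrib)
    qed
  qed
  have h: "h 0 = 1" "h 1 = - b" "h 2 = b\<^sup>2" "\<And>n. h (n + 3) = - b * h (n + 2) - a * h n"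
    by (simp_all add: h_def numeral_2_eq_2 numeral_3_eq_3)
  have sin_node: "sin (real (m + 1) * \<theta>) = (-1) ^ k"
  proof -
    have "real (m + 1) * \<theta> = pi / 2 + real k * pi"
      by (simp add: \<theta>_def node_def field_simps del: of_nat_add of_nat_Suc)
    then show ?thesis by (simp add: sin_add)
  qed
  define r where "r = \<zeta> * sin (real m * \<theta>) + \<zeta> ^ (m + 2) * sin \<theta>"
  have r: "\<bar>r\<bar> < 2"
  proof -
    have "\<bar>\<zeta> * sin (real m * \<theta>)\<bar> \<le> \<bar>\<zeta>\<bar>"
      by (simp add: abs_mult mult_left_le)
    moreover have "\<bar>\<zeta> ^ (m + 2) * sin \<theta>\<bar> \<le> 1 * 1"
      unfolding abs_mult power_abs using \<zeta> by (intro mult_mono power_le_one) auto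
    ultimately show ?thesis using \<zeta>(2) by (simp add: r_def)
  qed
  have "(2 + \<zeta>\<^sup>2) * sin \<theta> * ((-1) ^ k * h m) = (-1) ^ k * ((2 + \<zeta>\<^sup>2) * sin \<theta> * h m)"
    by simp
  also have "\<dots> = (-1) ^ k * (2 * (-1) ^ k + r)"
    unfolding recurrence_closed_form[where h = h, OF \<zeta>(1) b_def a_def h, of m] sin_node r_def
    by (simp only: add.assoc)
  also have "\<dots> > 0"
    using r by (cases "even k") auto
  finally have "(2 + \<zeta>\<^sup>2) * sin \<theta> * ((-1) ^ k * h m) > 0" .
  moreover have "(2 + \<zeta>\<^sup>2) * sin \<theta> > 0"
    using sin by (intro mult_pos_pos add_pos_nonneg) auto
  ultimately have "(-1) ^ k * h m > 0"
    by (rule zero_less_mult_pos)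
  moreover have "h m = (-1) ^ (m div 3) * (- b) ^ (m mod 3) * a ^ (m div 3)
      * poly (core_poly m) (angle_map \<theta>)"
  proof -
    have "(-1) ^ m * b ^ (m mod 3) = (-1) ^ (m div 3) * (- b) ^ (m mod 3)"
    proof -
      have "(-1 :: real) ^ m = (-1) ^ (3 * (m div 3)) * (-1) ^ (m mod 3)"
        by (metis mult_div_mod_eq power_add)
      also have "(-1 :: real) ^ (3 * (m div 3)) = (-1) ^ (m div 3)"
        by (simp add: power_mult)
      finally show ?thesis by (simp add: power_minus[of b])
    qed
    then show ?thesis
      using recurrence_eq_core_poly[where h = h, OF _ h, of m] ab by simp
  qed
  ultimately have "(- b) ^ (m mod 3) * a ^ (m div 3)
      * ((-1) ^ (m div 3 + k) * poly (core_poly m) (angle_map \<theta>)) > 0"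
    by (simp add: power_add mult_ac)
  moreover have "(- b) ^ (m mod 3) * a ^ (m div 3) > 0"
    using ab by simp
  ultimately show ?thesis
    unfolding \<theta>_def by (rule zero_less_mult_pos)
qed

lemma root_between_nodes:
  assumes "node m (Suc k) < pi / 3"
  shows "\<exists>x. angle_map (node m k) < x \<and> x < angle_map (node m (Suc k))
    \<and> poly (core_poly m) x = 0"
proof (rule poly_IVT)
  have lt: "0 \<le> node m k" "node m k < node m (Suc k)"
    by (simp_all add: node_def divide_strict_right_mono)
  then show "angle_map (node m k) < angle_map (node m (Suc k))"
    using assms by (intro angle_map_less) auto
  show "poly (core_poly m) (angle_map (node m k)) *
    poly (core_poly m) (angle_map (node m (Suc k))) < 0"
    using sign_core_poly_at_node[of m k] sign_core_poly_at_node[of m "Suc k"] lt assms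
    by (cases "even (m div 3 + k)") (auto simp: mult_neg_pos mult_pos_neg)
qed

section \<open>Location and density of the roots in the interval\<close>

text \<open>Sign changes along the \<open>m div 3\<close> nodes below \<open>\<pi>/3\<close> and the endpoint \<open>0\<close> produce \<open>m div 3\<close>
different roots in the interval, and the degree leaves room for no further complex root.\<close>

lemma core_poly_root_in_interval:
  fixes w :: complex
  assumes "poly (core_poly m) w = 0"
  shows "\<exists>x. w = of_real x \<and> - 27 / 4 < x \<and> x < 0"
proof -
  define q where "q = m div 3"
  \<comment> \<open>The images of the first \<open>q\<close> nodes, followed by the right endpoint \<open>0\<close> of the interval.\<close>
  define v where "v k = (if k < q then angle_map (node m k) else 0)" for k
  have node_lt: "node m k < pi / 3" if "k < q" for k
  proof -
    have "3 * real k + 3 \<le> real m"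
      using that unfolding q_def by simp
    then have "(real k + 1 / 2) * 3 < real (m + 1)" by simp
    then have "(real k + 1 / 2) * 3 * pi < real (m + 1) * pi" by simp
    then show ?thesis by (simp add: node_def field_simps)
  qed
  have node_pos: "0 < node m k" for k by (simp add: node_def)
  have v_range: "- 27 / 4 < v k" "v k \<le> 0" for k
    using angle_map_less[of 0 "node m k"] angle_map_less[of "node m k" "pi / 3"]
      node_lt[of k] node_pos[of k] by (auto simp: v_def angle_map_ends)
  have "\<exists>x. v k < x \<and> x < v (Suc k) \<and> poly (core_poly m) x = 0" if "k < q" for k
  proof (cases "Suc k < q")
    case True
    with root_between_nodes[of m k] node_lt[of "Suc k"] show ?thesis
      by (simp add: v_def)
  next
    case False
    with that have q: "q = Suc k" by simp
    have "v k < 0"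
      using angle_map_less[of "node m k" "pi / 3"] node_lt[OF that] node_pos[of k] that
      by (simp add: v_def angle_map_ends)
    moreover have "poly (core_poly m) (v k) * poly (core_poly m) 0 < 0"
      using sign_core_poly_at_node[of m k] node_lt[OF that] poly_core_poly_0_pos[of m] that
      by (simp add: v_def q mult_neg_pos flip: q_def)
    ultimately show ?thesis
      using poly_IVT[of "v k" 0] q by (auto simp: v_def)
  qed
  then obtain x where x: "\<And>k. k < q \<Longrightarrow> v k < x k \<and> x k < v (Suc k) \<and> poly (core_poly m) (x k) = 0"
    by metis
  have v_mono: "v i \<le> v j" if "i \<le> j" "j \<le> q" for i j
    using that
  proof (induction j rule: dec_induct)
    case (step n)
    then show ?case using x[of n] by force
  qed simp
  have x_less: "x i < x j" if "i < j" "j < q" for i j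
    using x[of i] x[of j] v_mono[of "Suc i" j] that by force
  define S where "S = (\<lambda>k. complex_of_real (x k)) ` {..<q}"
  have "inj_on (\<lambda>k. complex_of_real (x k)) {..<q}"
    by (intro linorder_inj_onI) (auto dest!: x_less)
  then have cardS: "card S = q" by (simp add: S_def card_image)
  let ?R = "{w :: complex. poly (core_poly m) w = 0}"
  have nz: "core_poly m \<noteq> (0 :: complex poly)"
    using poly_core_poly_of_real[of m 0] poly_core_poly_0_pos[of m] by auto
  have "S \<subseteq> ?R" using x by (auto simp: S_def poly_core_poly_of_real)
  moreover have "finite ?R" using nz by (rule poly_roots_finite)
  moreover have "card ?R \<le> q"
    using card_poly_roots_bound[OF nz] degree_core_poly[of m, where 'a = complex]
    unfolding q_def by linarith
  ultimately have "S = ?R" using cardS by (intro card_seteq) auto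
  with assms obtain k where "k < q" "w = of_real (x k)" by (auto simp: S_def)
  moreover have "- 27 / 4 < x k" "x k < 0"
    using x[OF \<open>k < q\<close>] v_range[of k] v_range[of "Suc k"] by auto
  ultimately show ?thesis by blast
qed

text \<open>Consecutive nodes, at distance \<open>\<pi> / (m + 1)\<close>, enclose a root.  So once \<open>m\<close> is large, every fixed nonempty open
set of angles contains two of them, and continuity of \<open>angle_map\<close> puts the root near \<open>w\<close>.\<close>

lemma core_poly_roots_dense:
  assumes w: "- 27 / 4 \<le> w" "w \<le> 0" and "\<epsilon> > 0"
  shows "\<forall>\<^sub>F m in sequentially. \<exists>x. \<bar>x - w\<bar> < \<epsilon> \<and> poly (core_poly m) x = (0 :: real)"
proof -
  obtain \<theta> where \<theta>: "0 \<le> \<theta>" "\<theta> \<le> pi / 3" "angle_map \<theta> = w"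
    using IVT'[of angle_map 0 w "pi / 3"] w continuous_on_angle_map by (auto simp: angle_map_ends)
  obtain \<delta> where \<delta>: "\<delta> > 0"
    "\<And>\<phi>. 0 \<le> \<phi> \<Longrightarrow> \<phi> \<le> pi / 3 \<Longrightarrow> \<bar>\<phi> - \<theta>\<bar> < \<delta> \<Longrightarrow> \<bar>angle_map \<phi> - w\<bar> < \<epsilon>"
    using continuous_on_angle_map[unfolded continuous_on_iff, rule_format, of \<theta> \<epsilon>] \<theta> \<open>\<epsilon> > 0\<close>
    by (auto simp: dist_real_def)
  define \<alpha> \<beta> where "\<alpha> = max 0 (\<theta> - \<delta>)" and "\<beta> = min (pi / 3) (\<theta> + \<delta>)"
  have \<alpha>\<beta>: "\<alpha> < \<beta>" "0 \<le> \<alpha>" using \<theta> \<delta>(1) pi_gt_zero unfolding \<alpha>_def \<beta>_def by linarith+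
  \<comment> \<open>With \<open>k\<close> obtained by rounding \<open>\<alpha> (m + 1) / \<pi>\<close> up, the nodes \<open>k\<close> and \<open>k + 1\<close> both lie in the
    window from \<open>\<alpha>\<close> to \<open>\<alpha> + 5/2 \<pi> / (m + 1)\<close>: at most \<open>1\<close> from rounding, \<open>1/2\<close> from the offset of
    the nodes and \<open>1\<close> from the step.\<close>
  have "\<forall>\<^sub>F m in sequentially. 5 / 2 * pi / (\<beta> - \<alpha>) < real m"
    using filterlim_real_sequentially by (simp add: filterlim_at_top_dense)
  then show ?thesis
  proof eventually_elim
    case (elim m)
    define k where "k = nat \<lceil>\<alpha> * real (m + 1) / pi\<rceil>"
    have k: "\<alpha> * real (m + 1) / pi \<le> real k" "real k < \<alpha> * real (m + 1) / pi + 1"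
    proof -
      have "0 \<le> \<alpha> * real (m + 1) / pi" using \<alpha>\<beta>(2) by simp
      then show "\<alpha> * real (m + 1) / pi \<le> real k" "real k < \<alpha> * real (m + 1) / pi + 1"
        unfolding k_def by linarith+
    qed
    have "\<alpha> < node m k"
    proof -
      have "\<alpha> * real (m + 1) \<le> real k * pi"
        using k(1) by (simp add: pos_divide_le_eq)
      also have "\<dots> < (real k + 1 / 2) * pi"
        by (simp add: distrib_right)
      finally have "\<alpha> * real (m + 1) < (real k + 1 / 2) * pi" .
      then show ?thesis by (simp add: node_def field_simps)
    qed
    moreover have "node m k < node m (Suc k)"
      by (simp add: node_def divide_strict_right_mono)
    moreover have "node m (Suc k) < \<beta>"
    proof -
      have "5 / 2 * pi < (\<beta> - \<alpha>) * real (m + 1)"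
        using elim \<alpha>\<beta> by (simp add: field_simps)
      moreover have "real k * pi < \<alpha> * real (m + 1) + pi"
        using k(2) by (simp add: field_simps)
      ultimately have "(real (Suc k) + 1 / 2) * pi < \<beta> * real (m + 1)"
        by (simp add: algebra_simps)
      then show ?thesis by (simp add: node_def field_simps)
    qed
    ultimately have nodes: "\<alpha> < node m k" "node m k < \<beta>" "\<alpha> < node m (Suc k)" "node m (Suc k) < \<beta>"
      by linarith+
    then obtain x where "angle_map (node m k) < x" "x < angle_map (node m (Suc k))"
      "poly (core_poly m) x = 0"
      using root_between_nodes[of m k] by (auto simp: \<beta>_def)
    moreover have "\<bar>angle_map \<phi> - w\<bar> < \<epsilon>" if "\<alpha> < \<phi>" "\<phi> < \<beta>" for \<phi>
      using that by (intro \<delta>(2)) (auto simp: \<alpha>_def \<beta>_def)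
    ultimately show ?case
      using nodes by (intro exI[of _ x]) (smt (verit))
  qed
qed

section \<open>From the interval to the curve\<close>

lemma has_genfun3_recurrence:
  assumes "has_genfun3 A B H"
  shows "H 0 = 1" "H 1 = - B" "H 2 = B\<^sup>2" "H (n + 3) = - B * H (n + 2) - A * H n"
proof -
  have eq: "H n + (if n = 0 then 0 else B * H (n - 1)) + (if n < 3 then 0 else A * H (n - 3))
      = (if n = 0 then 1 else 0)" for n
  proof -
    have "Abs_fps H * (1 + fps_const B * fps_X + fps_const A * fps_X ^ 3)
        = Abs_fps H + fps_const B * (Abs_fps H * fps_X) + fps_const A * (Abs_fps H * fps_X ^ 3)"
      by (simp add: algebra_simps)
    also have "\<dots> $ n = H n + (if n = 0 then 0 else B * H (n - 1))
        + (if n < 3 then 0 else A * H (n - 3))"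
      by (simp add: fps_X_power_mult_right_nth)
    finally show ?thesis using assms by (simp add: has_genfun3_def)
  qed
  show H0: "H 0 = 1" using eq[of 0] by simp
  show H1: "H 1 = - B" using eq[of 1] H0 by (simp add: eq_neg_iff_add_eq_0)
  show "H 2 = B\<^sup>2" using eq[of 2] H1 by (simp add: power2_eq_square)
  show "H (n + 3) = - B * H (n + 2) - A * H n"
    using eq[of "n + 3"] by (simp add: numeral_3_eq_3) (simp add: eq_neg_iff_add_eq_0 algebra_simps)
qed

lemma poly_genfun3_eq_core_poly:
  assumes H: "has_genfun3 A B H" and A: "poly A z \<noteq> 0"
  shows "poly (H m) z = (-1) ^ m * poly B z ^ (m mod 3) * poly A z ^ (m div 3)
    * poly (core_poly m) (poly B z ^ 3 / poly A z)"
  by (rule recurrence_eq_core_poly[where h = "\<lambda>m. poly (H m) z", OF A])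
    (simp_all only: has_genfun3_recurrence[OF H] poly_1 poly_minus poly_power poly_diff poly_mult)

text \<open>A root of \<open>H\<^sub>m\<close> with \<open>A(z) \<noteq> 0\<close> has \<open>B(z) = 0\<close>, hence \<open>w = 0\<close>, or it makes \<open>w\<close> a root of \<open>core_poly\<close>.  For the
density, the complement of the zeros of \<open>A\<close> is open and connected, so \<open>B\<^sup>3 / A\<close> maps a neighbourhood of \<open>p\<close> onto
a neighbourhood of a point of the interval, and that contains roots of \<open>core_poly\<close> for all large \<open>m\<close>.\<close>

theorem theorem3:
  fixes A B :: "complex poly" and H :: "nat \<Rightarrow> complex poly"
  assumes "has_genfun3 A B H"
  shows "(\<forall>m z. poly (H m) z = 0 \<and> poly A z \<noteq> 0 \<longrightarrow> z \<in> curve3 A B) \<and>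
    (\<not> (\<lambda>z. poly B z ^ 3 / poly A z) constant_on {z. poly A z \<noteq> 0} \<longrightarrow>
      (\<forall>p\<in>curve3 A B. \<forall>U. open U \<and> p \<in> U \<longrightarrow>
        (\<forall>\<^sub>F m in sequentially. \<exists>z\<in>U. poly (H m) z = 0 \<and> poly A z \<noteq> 0)))"
proof (intro conjI allI impI ballI)
  fix m z
  assume z: "poly (H m) z = 0 \<and> poly A z \<noteq> 0"
  show "z \<in> curve3 A B"
  proof (cases "poly B z = 0")
    case True
    then show ?thesis using z by (simp add: curve3_def)
  next
    case False
    then have "poly (core_poly m) (poly B z ^ 3 / poly A z) = 0"
      using z poly_genfun3_eq_core_poly[OF assms, of z m] by simp
    from core_poly_root_in_interval[OF this] obtain x where
      "poly B z ^ 3 / poly A z = of_real x" "- 27 / 4 < x" "x < 0" by blast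
    then show ?thesis using z by (simp add: curve3_def)
  qed
next
  define f where "f = (\<lambda>z. poly B z ^ 3 / poly A z)"
  define S where "S = {z. poly A z \<noteq> 0}"
  fix p U
  assume "\<not> (\<lambda>z. poly B z ^ 3 / poly A z) constant_on {z. poly A z \<noteq> 0}"
  then have nonconst: "\<not> f constant_on S" by (simp add: f_def S_def)
  assume p: "p \<in> curve3 A B" and U: "open U \<and> p \<in> U"
  have pS: "p \<in> S" using p by (simp add: curve3_def S_def)
  define w where "w = Re (f p)"
  have fp: "f p = of_real w" "- 27 / 4 \<le> w" "w \<le> 0"
    using p unfolding curve3_def w_def f_def by (simp_all add: complex_eq_iff)
  have "A \<noteq> 0" using pS by (auto simp: S_def)
  then have fin: "finite (- S)" by (simp add: S_def Compl_eq poly_roots_finite)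
  have S: "open S" "connected S"
  proof -
    show "open S" using finite_imp_closed[OF fin] by (simp add: closed_def)
    have "connected (UNIV - (- S))"
      using fin by (intro connected_open_delete_finite) auto
    then show "connected S" by (simp add: Diff_eq)
  qed
  have hol: "f holomorphic_on S"
    unfolding f_def S_def by (intro holomorphic_intros) auto
  have "open (f ` (U \<inter> S))"
    using U S by (intro open_mapping_thm[OF hol S _ _ nonconst]) auto
  moreover have "of_real w \<in> f ` (U \<inter> S)"
    using U pS by (auto simp flip: fp(1))
  ultimately obtain \<epsilon> where \<epsilon>: "\<epsilon> > 0" "ball (of_real w) \<epsilon> \<subseteq> f ` (U \<inter> S)"
    using open_contains_ball by blast
  show "\<forall>\<^sub>F m in sequentially. \<exists>z\<in>U. poly (H m) z = 0 \<and> poly A z \<noteq> 0"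
    using core_poly_roots_dense[OF fp(2,3) \<epsilon>(1)]
  proof eventually_elim
    case (elim m)
    then obtain x where x: "\<bar>x - w\<bar> < \<epsilon>" "poly (core_poly m) x = 0" by blast
    have "complex_of_real x \<in> ball (of_real w) \<epsilon>"
      using x(1) by (simp add: dist_norm norm_minus_commute flip: of_real_diff)
    with \<epsilon>(2) have "complex_of_real x \<in> f ` (U \<inter> S)"
      by (rule subsetD)
    then obtain z where "of_real x = f z" "z \<in> U \<inter> S"
      by (rule imageE)
    then have z: "z \<in> U" "z \<in> S" "f z = of_real x"
      by auto
    then have "poly (H m) z = 0"
      using poly_genfun3_eq_core_poly[OF assms, of z m] x(2) poly_core_poly_of_real[of m x]
      by (simp add: S_def f_def)
    then show ?case using z by (auto simp: S_def)
  qed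
qed

end
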